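(* Let $A$ be an open subset of $\mathbb{E}^n$ with $A\neq\mathbb{E}^n$. Then the function $i_A$ on $A\times A$ defined by $$i_A(x,y)=\log\left(1+\frac{|x-y|}{d(x,\partial A)}\right)=\sup_{a\in\partial A}\log\left(1+\frac{|x-y|}{|x-a|}\right)$$ is a weak metric on $A$.
   Context: $\mathbb{E}^n$ is Euclidean $n$-space, $|x-y|$ is the Euclidean distance, $\partial A=\overline{A}\setminus A$, and $d(x,\partial A)=\inf_{a\in\partial A}|x-a|$. A weak metric on a set $X$ is a function $\delta:X\times X\to[0,\infty)$ such that $\delta(x,x)=0$ for all $x\in X$ and $\delta(x,y)+\delta(y,z)\ge\delta(x,z)$ for all $x,y,z\in X$ (no symmetry or separation is required). *)

theory Defs
  imports "HOL-Analysis.Analysis"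
begin

definition weak_metric_on :: "'a set \<Rightarrow> ('a \<Rightarrow> 'a \<Rightarrow> real) \<Rightarrow> bool" where
  "weak_metric_on X \<delta> \<longleftrightarrow>
     (\<forall>x\<in>X. \<forall>y\<in>X. \<delta> x y \<ge> 0) \<and>
     (\<forall>x\<in>X. \<delta> x x = 0) \<and>
     (\<forall>x\<in>X. \<forall>y\<in>X. \<forall>z\<in>X. \<delta> x y + \<delta> y z \<ge> \<delta> x z)"

(* Not frontier, which removes interior A instead of A; the two agree when A is open. *)
definition bdry :: "'a::topological_space set \<Rightarrow> 'a set" where
  "bdry A = closure A - A"

definition i_weak :: "(real ^ 'n) set \<Rightarrow> real ^ 'n \<Rightarrow> real ^ 'n \<Rightarrow> real" where
  "i_weak A x y = ln (1 + dist x y / infdist x (bdry A))"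

end

theory Submission imports Defs begin

(* The triangle inequality rests on the distance r to the boundary being 1-Lipschitz:
   since r y \<le> r x + |x - y|, we get
   (r x + |x - y|) (1 + |y - z| / r y) \<ge> r x + |x - y| + |y - z| \<ge> r x + |x - z|,
   and dividing by r x and taking logarithms gives the claim.  The supremum is attained
   at a nearest boundary point. *)

lemma closed_bdry:
  assumes "open A"
  shows "closed (bdry A)"
  using assms by (simp add: bdry_def closed_Diff)

text \<open>By connectedness of the space: an open set with empty boundary is clopen. Nonemptiness
  matters because \<open>infdist\<close> to the empty set is 0 by convention.\<close>

lemma bdry_nonempty:
  fixes A :: "'a::real_normed_vector set"
  assumes "open A" "A \<noteq> UNIV" "A \<noteq> {}"
  shows "bdry A \<noteq> {}"
proof
  assume "bdry A = {}"
  then have "closed A"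
    by (simp add: bdry_def closure_subset_eq)
  with assms show False using clopen[of A] by blast
qed

lemma infdist_bdry_pos:
  fixes A :: "'a::real_normed_vector set"
  assumes "open A" "A \<noteq> UNIV" "x \<in> A"
  shows "infdist x (bdry A) > 0"
  using assms bdry_nonempty[of A] infdist_pos_not_in_closed[OF closed_bdry, of A x]
  by (auto simp: bdry_def)

text \<open>A nearest boundary point exists since \<open>bdry A\<close> is closed and nonempty and
  closed balls are compact. Taking the supremum in the complete lattice \<open>ereal\<close> makes
  it meaningful without a separate boundedness proof.\<close>

lemma i_weak_eq_SUP:
  assumes A: "open A" "A \<noteq> UNIV" and x: "x \<in> A"
  shows "ereal (i_weak A x y) = (SUP a\<in>bdry A. ereal (ln (1 + dist x y / dist x a)))"
proof -
  have ne: "bdry A \<noteq> {}" using A x bdry_nonempty by blast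
  have pos: "infdist x (bdry A) > 0" using A x by (rule infdist_bdry_pos)
  obtain b where b: "b \<in> bdry A" "infdist x (bdry A) = dist x b"
    using infdist_attains_inf[OF closed_bdry[OF A(1)] ne] by blast
  show ?thesis
  proof (rule antisym)
    show "ereal (i_weak A x y) \<le> (SUP a\<in>bdry A. ereal (ln (1 + dist x y / dist x a)))"
      using b by (intro SUP_upper2[of b]) (auto simp: i_weak_def)
    have "ln (1 + dist x y / dist x a) \<le> i_weak A x y" if "a \<in> bdry A" for a
    proof -
      have "infdist x (bdry A) \<le> dist x a" using that by (rule infdist_le)
      then have "dist x y / dist x a \<le> dist x y / infdist x (bdry A)"
        using pos by (intro divide_left_mono mult_pos_pos) auto
      then show ?thesis unfolding i_weak_def
        by (intro ln_mono) (auto intro: add_pos_nonneg)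
    qed
    then show "(SUP a\<in>bdry A. ereal (ln (1 + dist x y / dist x a))) \<le> ereal (i_weak A x y)"
      by (intro SUP_least) simp
  qed
qed

lemma i_weak_triangle:
  assumes A: "open A" "A \<noteq> UNIV" and xy: "x \<in> A" "y \<in> A"
  shows "i_weak A x z \<le> i_weak A x y + i_weak A y z"
proof -
  define r s where "r = infdist x (bdry A)" and "s = infdist y (bdry A)"
  have r: "r > 0" and s: "s > 0"
    using infdist_bdry_pos[OF A] xy by (auto simp: r_def s_def)
  have "s \<le> r + dist x y"
    using infdist_triangle[of y "bdry A" x] by (simp add: r_def s_def dist_commute)
  \<comment> \<open>Scaling the Lipschitz bound by \<open>dist y z / s\<close> lets the cross term
    of the product below absorb \<open>dist y z\<close>.\<close>
  then have "dist y z * s \<le> dist y z * (r + dist x y)"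
    by (intro mult_left_mono) auto
  then have *: "dist y z \<le> (r + dist x y) * (dist y z / s)"
    using s by (simp add: field_simps)
  have "r + dist x z \<le> r + dist x y + dist y z"
    using dist_triangle[of x z y] by simp
  also have "\<dots> \<le> (r + dist x y) * (1 + dist y z / s)"
    using * by (simp add: distrib_left)
  finally have "(r + dist x z) / r \<le> (r + dist x y) * (1 + dist y z / s) / r"
    using r by (intro divide_right_mono) auto
  moreover have "(r + d) / r = 1 + d / r" for d
    using r by (simp add: add_divide_distrib)
  ultimately have "1 + dist x z / r \<le> (1 + dist x y / r) * (1 + dist y z / s)"
    by (metis times_divide_eq_left)
  \<comment> \<open>Positivity of the factors turns \<open>ln\<close> of the product into a
    sum.\<close>
  moreover have "1 + dist x z / r > 0" "1 + dist x y / r > 0" "1 + dist y z / s > 0"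
    using r s by (auto intro: add_pos_nonneg)
  ultimately show ?thesis
    unfolding i_weak_def r_def[symmetric] s_def[symmetric]
    by (metis ln_mono ln_mult_pos)
qed

theorem proposition1p4:
  fixes A :: "(real ^ 'n) set"
  assumes "open A" and "A \<noteq> UNIV"
  shows "(\<forall>x\<in>A. \<forall>y\<in>A.
            ereal (i_weak A x y) = (SUP a\<in>bdry A. ereal (ln (1 + dist x y / dist x a)))) \<and>
         weak_metric_on A (i_weak A)"
proof -
  \<comment> \<open>These hold even where \<open>infdist\<close> vanishes, since division by 0
    yields 0 and \<open>ln 1 = 0\<close>.\<close>
  have "i_weak A x y \<ge> 0" "i_weak A x x = 0" for x y
    by (auto simp: i_weak_def infdist_nonneg)
  then show ?thesis
    using i_weak_eq_SUP[OF assms] i_weak_triangle[OF assms]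
    by (auto simp: weak_metric_on_def)
qed

end
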